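(* Let $H \in \mathbb{R}^{n\times n}$ be symmetric positive definite, let $c \in \mathbb{R}^n$, and let $q:\mathbb{R}^n\to\mathbb{R}$ be given by $q(x) = \frac12 x^T H x + c^T x$. For a given initial point $x_0\in\mathbb{R}^n$, let $x_k$, $k=1,2,\dots$, be defined (successively) as the minimizer of $q(x)$ subject to $x \in x_0 + \operatorname{span}(\{g_0,\dots,g_{k-1}\})$, where $g_i = \nabla q(x_i)$, $i=0,1,\dots$. Then, for every $k\ge 1$, $x_k$ is well defined (the minimizer exists and is unique), and it is characterized by orthogonality of the gradients: a point $x \in x_0 + \operatorname{span}(\{g_0,\dots,g_{k-1}\})$ equals $x_k$ if and only if $\nabla q(x)^T g_i = 0$ for all $i=0,\dots,k-1$; that is, $x_k$ is characterized within this affine subspace by $$g_k^T g_i = 0,\quad i=0,\dots,k-1.$$ In addition, there is an integer $r$ with $0\le r\le n$ such that $g_r = 0$ and $g_k\neq 0$ for $k=0,\dots,r-1$.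
   Context: Here $\operatorname{span}$ denotes the linear span in $\mathbb{R}^n$, and $x_0+\mathcal{S} = \{x_0+s : s\in\mathcal{S}\}$ for a linear subspace $\mathcal{S}$. Note that $\nabla q(x) = Hx+c$, so $g_k = Hx_k+c$. *)

theory Defs
  imports "HOL-Analysis.Analysis"
begin

definition sym_pos_def :: "real^'n^'n \<Rightarrow> bool" where
  "sym_pos_def A \<longleftrightarrow> transpose A = A \<and> (\<forall>x. x \<noteq> 0 \<longrightarrow> x \<bullet> (A *v x) > 0)"

definition quadratic :: "real^'n^'n \<Rightarrow> real^'n \<Rightarrow> real^'n \<Rightarrow> real" where
  "quadratic H c x = 1/2 * (x \<bullet> (H *v x)) + c \<bullet> x"

(* The Riesz representative of the Frechet derivative; unspecified where f is not differentiable. *)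
definition gradient :: "('a::real_inner \<Rightarrow> real) \<Rightarrow> 'a \<Rightarrow> 'a" where
  "gradient f x = (THE g. (f has_derivative (\<lambda>h. g \<bullet> h)) (at x))"

(* The iterates x_k. Uniqueness of the minimizer is not built in: THE denotes the minimizer
   only when there is exactly one. *)
fun iterate :: "('a::real_inner \<Rightarrow> real) \<Rightarrow> 'a \<Rightarrow> nat \<Rightarrow> 'a" where
  "iterate f x0 0 = x0"
| "iterate f x0 (Suc k) =
     (THE x. is_arg_min f
        (\<lambda>y. y \<in> (+) x0 ` span ((\<lambda>i. gradient f (iterate f x0 i)) ` {..<Suc k})) x)"

definition iterate_grad :: "('a::real_inner \<Rightarrow> real) \<Rightarrow> 'a \<Rightarrow> nat \<Rightarrow> 'a" where
  "iterate_grad f x0 k = gradient f (iterate f x0 k)"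

definition search_space :: "('a::real_inner \<Rightarrow> real) \<Rightarrow> 'a \<Rightarrow> nat \<Rightarrow> 'a set" where
  "search_space f x0 k = (+) x0 ` span (iterate_grad f x0 ` {..<k})"

lemma iterate_eq:
  "k \<ge> 1 \<Longrightarrow> iterate f x0 k = (THE x. is_arg_min f (\<lambda>y. y \<in> search_space f x0 k) x)"
  unfolding search_space_def iterate_grad_def by (cases k) simp_all

lemma gradient_eqI:
  assumes "(f has_derivative (\<lambda>h. g \<bullet> h)) (at x)"
  shows "gradient f x = g"
  unfolding gradient_def
proof (rule the_equality)
  show "(f has_derivative (\<lambda>h. g \<bullet> h)) (at x)" by (rule assms)
next
  fix g' assume "(f has_derivative (\<lambda>h. g' \<bullet> h)) (at x)"
  from has_derivative_unique[OF this assms] have "\<And>h. g' \<bullet> h = g \<bullet> h" by metis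
  thus "g' = g" by (metis vector_eq_rdot)
qed

lemma gradient_quadratic:
  assumes "transpose H = H"
  shows "gradient (quadratic H c) x = H *v x + c"
proof (rule gradient_eqI)
  have d: "((\<lambda>y. H *v y) has_derivative (\<lambda>h. H *v h)) (at x)"
    by (intro bounded_linear.has_derivative[OF matrix_vector_mul_bounded_linear] has_derivative_ident)
  have "(H *v x) \<bullet> h = x \<bullet> (H *v h)" for h
    using assms by (metis dot_lmul_matrix transpose_matrix_vector)
  hence eq: "(\<lambda>h. (H *v x + c) \<bullet> h)
      = (\<lambda>h. 1/2 * (x \<bullet> (H *v h) + h \<bullet> (H *v x)) + c \<bullet> h)"
    by (auto simp: inner_add_left inner_add_right inner_commute)
  show "(quadratic H c has_derivative (\<lambda>h. (H *v x + c) \<bullet> h)) (at x)"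
    unfolding eq quadratic_def
    by (intro has_derivative_add has_derivative_mult_right has_derivative_inner
        has_derivative_inner_right has_derivative_ident d)
qed

end

theory Submission
  imports Defs
begin

text \<open>
  On an affine subspace \<open>x0 + S\<close> the quadratic has the exact expansion
  \<open>q (z + s) = q z + (H z + c) \<bullet> s + 1/2 * (s \<bullet> H s)\<close>. Positive definiteness therefore makes
  \<open>z\<close> a minimizer precisely when its gradient is orthogonal to \<open>S\<close>
  (\<open>is_arg_min_quadratic_affine_iff\<close>). Positive definiteness also makes \<open>H\<close> map \<open>S\<close> injectively onto a
  subspace that meets the orthogonal complement of \<open>S\<close> only in \<open>0\<close>; by counting dimensions the
  two span the whole space, so the linear system behind the orthogonality condition is solvable,
  and its solution is unique (\<open>ex1_orthogonal_gradient\<close>).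

  With \<open>S\<close> the span of the earlier gradients, each new gradient is orthogonal to all earlier
  ones. At most \<open>CARD('n)\<close> pairwise orthogonal vectors can be nonzero, so one of the gradients
  with index up to \<open>CARD('n)\<close> vanishes, and \<open>r\<close> is the first index where this happens.
\<close>

section \<open>Minimizing a quadratic over an affine subspace\<close>

lemma quadratic_add:
  fixes H :: "real^'n^'n"
  assumes "transpose H = H"
  shows "quadratic H c (z + s) = quadratic H c z + (H *v z + c) \<bullet> s + 1/2 * (s \<bullet> (H *v s))"
proof -
  have "(H *v z) \<bullet> s = z \<bullet> (H *v s)"
    using assms by (metis dot_lmul_matrix transpose_matrix_vector)
  moreover have "s \<bullet> (H *v z) = (H *v z) \<bullet> s" by (rule inner_commute)
  ultimately show ?thesis
    unfolding quadratic_def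
    by (simp add: matrix_vector_right_distrib inner_add_left inner_add_right field_simps)
qed

text \<open>Along a direction \<open>s\<close> with nonzero slope \<open>(H z + c) \<bullet> s\<close> the quadratic is a parabola whose
  vertex lies strictly below \<open>q z\<close>; without such a direction the curvature term only increases
  the value.\<close>

lemma is_arg_min_quadratic_affine_iff:
  fixes H :: "real^'n^'n"
  assumes H: "sym_pos_def H" and S: "subspace S" and z: "z \<in> (+) x0 ` S"
  shows "is_arg_min (quadratic H c) (\<lambda>y. y \<in> (+) x0 ` S) z \<longleftrightarrow> (\<forall>s\<in>S. (H *v z + c) \<bullet> s = 0)"
    (is "?min \<longleftrightarrow> ?orth")
proof -
  have sym: "transpose H = H" and pos: "\<And>x. x \<noteq> 0 \<Longrightarrow> x \<bullet> (H *v x) > 0"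
    using H by (auto simp: sym_pos_def_def)
  obtain s0 where s0: "s0 \<in> S" "z = x0 + s0" using z by auto
  show ?thesis
  proof
    assume min: ?min
    show ?orth
    proof (intro ballI, rule ccontr)
      fix s assume s: "s \<in> S" and slope: "(H *v z + c) \<bullet> s \<noteq> 0"
      define a where "a = (H *v z + c) \<bullet> s"
      define p where "p = s \<bullet> (H *v s)"
      have "s \<noteq> 0" using slope by auto
      then have p: "p > 0" using pos by (simp add: p_def)
      define t where "t = - a / p" \<comment> \<open>the vertex of \<open>t \<mapsto> q (z + t s)\<close>\<close>
      have "quadratic H c (z + t *\<^sub>R s) = quadratic H c z + t * a + 1/2 * (t * (t * p))"
        by (simp add: quadratic_add[OF sym] a_def p_def matrix_vector_mult_scaleR)
      also have "\<dots> = quadratic H c z - a * a / (2 * p)"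
        using p by (simp add: t_def field_simps)
      also have "\<dots> < quadratic H c z"
      proof -
        have "a * a > 0" using slope by (metis a_def not_real_square_gt_zero)
        then show ?thesis using p by simp
      qed
      finally have "quadratic H c (z + t *\<^sub>R s) < quadratic H c z" .
      moreover have "z + t *\<^sub>R s \<in> (+) x0 ` S"
      proof
        show "z + t *\<^sub>R s = x0 + (s0 + t *\<^sub>R s)" using s0(2) by (simp add: add.assoc)
        show "s0 + t *\<^sub>R s \<in> S" using S s0(1) s by (simp add: subspace_add subspace_scale)
      qed
      ultimately show False using min by (auto simp: is_arg_min_def)
    qed
  next
    assume orth: ?orth
    have "quadratic H c z \<le> quadratic H c y" if "y \<in> (+) x0 ` S" for y
    proof -
      obtain s1 where s1: "s1 \<in> S" "y = x0 + s1" using \<open>y \<in> (+) x0 ` S\<close> by auto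
      define s where "s = s1 - s0"
      have "s \<in> S" "y = z + s" using s0 s1 S by (auto simp: s_def subspace_diff)
      moreover have "s \<bullet> (H *v s) \<ge> 0" using pos[of s] by (cases "s = 0") auto
      ultimately show ?thesis using orth by (simp add: quadratic_add[OF sym])
    qed
    then show ?min using z by (force simp: is_arg_min_def)
  qed
qed

text \<open>If \<open>H s\<close> is orthogonal to \<open>S\<close> for some \<open>s \<in> S\<close>, then \<open>s \<bullet> H s = 0\<close> and hence \<open>s = 0\<close>. This
  gives uniqueness directly, and existence because \<open>H\<close> then embeds \<open>S\<close> as a complement of
  \<open>S\<^sup>\<bottom>\<close>, so that the gradient at \<open>x0\<close> can be moved into \<open>S\<^sup>\<bottom>\<close> by subtracting an element
  of \<open>H S\<close>.\<close>

lemma ex1_orthogonal_gradient: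
  fixes H :: "real^'n^'n"
  assumes H: "sym_pos_def H" and S: "subspace S"
  shows "\<exists>!z. z \<in> (+) x0 ` S \<and> (\<forall>s\<in>S. (H *v z + c) \<bullet> s = 0)"
proof -
  have pos: "\<And>x. x \<noteq> 0 \<Longrightarrow> x \<bullet> (H *v x) > 0"
    using H by (auto simp: sym_pos_def_def)
  have lin: "linear ((*v) H)" by (rule matrix_vector_mul_linear)
  have zero: "s = 0" if "s \<in> S" "\<forall>v\<in>S. (H *v s) \<bullet> v = 0" for s
    using that pos[of s] by (force simp: inner_commute)
  define T where "T = (*v) H ` S"
  define C where "C = {y. \<forall>s\<in>S. orthogonal s y}"
  have subT: "subspace T" unfolding T_def using lin S by (rule linear_subspace_image)
  have subC: "subspace C" unfolding C_def by (rule subspace_orthogonal_to_vectors)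
  have "inj ((*v) H)"
    unfolding linear_injective_0[OF lin] using pos by (metis inner_zero_right less_irrefl)
  then have dimT: "dim T = dim S"
    unfolding T_def using lin by (metis dim_image_eq inj_on_subset subset_UNIV)
  have dimC: "dim C + dim S = CARD('n)"
    using dim_subspace_orthogonal_to_vectors[OF S subspace_UNIV] by (simp add: C_def)
  have "T \<inter> C \<subseteq> {0}"
  proof
    fix y assume "y \<in> T \<inter> C"
    then obtain s where "s \<in> S" "y = H *v s" "\<forall>v\<in>S. (H *v s) \<bullet> v = 0"
      by (auto simp: T_def C_def orthogonal_def inner_commute)
    then show "y \<in> {0}" using zero[of s] by simp
  qed
  then have "dim (T \<inter> C) = 0" by (simp add: dim_eq_0)
  then have "dim {x + y | x y. x \<in> T \<and> y \<in> C} = DIM(real^'n)"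
    using dim_sums_Int[OF subT subC] dimT dimC \<open>dim (T \<inter> C) = 0\<close>
    unfolding DIM_cart DIM_real by linarith
  then have "span {x + y | x y. x \<in> T \<and> y \<in> C} = UNIV"
    by (simp only: dim_eq_full)
  then have "{x + y | x y. x \<in> T \<and> y \<in> C} = UNIV"
    by (simp only: span_eq_iff[THEN iffD2, OF subspace_sums[OF subT subC]])
  then obtain t u where tu: "t \<in> T" "u \<in> C" "H *v x0 + c = t + u" by blast
  then obtain s where s: "s \<in> S" "t = H *v s" by (auto simp: T_def)
  show ?thesis
  proof (rule ex1I)
    have "H *v (x0 + - s) + c = u"
      using tu(3) s(2) by (simp add: matrix_vector_mult_diff_distrib algebra_simps)
    then have "\<forall>v\<in>S. (H *v (x0 + - s) + c) \<bullet> v = 0"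
      using tu(2) by (simp add: C_def orthogonal_def inner_commute)
    moreover have "- s \<in> S" using S s(1) by (rule subspace_neg)
    ultimately show "x0 + - s \<in> (+) x0 ` S \<and> (\<forall>v\<in>S. (H *v (x0 + - s) + c) \<bullet> v = 0)"
      by blast
    fix z assume z: "z \<in> (+) x0 ` S \<and> (\<forall>v\<in>S. (H *v z + c) \<bullet> v = 0)"
    then obtain w where w: "w \<in> S" "z = x0 + w" by auto
    have "w + s = 0"
    proof (rule zero)
      show "w + s \<in> S" using S w(1) s(1) by (rule subspace_add)
      have "H *v (w + s) = (H *v z + c) - u"
        using tu(3) s(2) w(2) by (simp add: matrix_vector_right_distrib algebra_simps)
      then show "\<forall>v\<in>S. (H *v (w + s)) \<bullet> v = 0"
        using z tu(2) by (simp add: C_def orthogonal_def inner_commute inner_diff_right)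
    qed
    then show "z = x0 + - s" using w(2) by (simp add: add_eq_0_iff)
  qed
qed

section \<open>The iterates and their gradients\<close>

lemma inner_span_image_eq_0_iff:
  "(\<forall>s\<in>span (g ` {..<k}). a \<bullet> s = 0) \<longleftrightarrow> (\<forall>i<k. a \<bullet> g i = 0)"
  (is "?L \<longleftrightarrow> ?R")
proof
  show "?L \<Longrightarrow> ?R" by (simp add: span_base)
  assume ?R
  have "orthogonal a s" if "s \<in> span (g ` {..<k})" for s
    by (rule orthogonal_to_span[OF that]) (use \<open>?R\<close> in \<open>auto simp: orthogonal_def\<close>)
  then show ?L by (simp add: orthogonal_def)
qed

lemma is_arg_min_search_space_iff:
  fixes H :: "real^'n^'n"
  assumes "sym_pos_def H"
  shows "is_arg_min (quadratic H c) (\<lambda>y. y \<in> search_space (quadratic H c) x0 k) z \<longleftrightarrow>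
    z \<in> search_space (quadratic H c) x0 k \<and>
    (\<forall>i<k. gradient (quadratic H c) z \<bullet> iterate_grad (quadratic H c) x0 i = 0)"
proof -
  have grad: "gradient (quadratic H c) z = H *v z + c"
    using assms by (simp add: gradient_quadratic sym_pos_def_def)
  have "is_arg_min (quadratic H c) (\<lambda>y. y \<in> search_space (quadratic H c) x0 k) z \<Longrightarrow>
    z \<in> search_space (quadratic H c) x0 k"
    by (simp add: is_arg_min_def)
  moreover have "is_arg_min (quadratic H c) (\<lambda>y. y \<in> search_space (quadratic H c) x0 k) z \<longleftrightarrow>
    (\<forall>i<k. gradient (quadratic H c) z \<bullet> iterate_grad (quadratic H c) x0 i = 0)"
    if "z \<in> search_space (quadratic H c) x0 k"
    using is_arg_min_quadratic_affine_iff[OF assms subspace_span that[unfolded search_space_def]]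
    by (simp only: grad search_space_def inner_span_image_eq_0_iff)
  ultimately show ?thesis by blast
qed

lemma ex1_minimizer_search_space:
  fixes H :: "real^'n^'n"
  assumes "sym_pos_def H"
  shows "\<exists>!x. is_arg_min (quadratic H c) (\<lambda>y. y \<in> search_space (quadratic H c) x0 k) x"
proof -
  have grad: "gradient (quadratic H c) z = H *v z + c" for z
    using assms by (simp add: gradient_quadratic sym_pos_def_def)
  show ?thesis
    using ex1_orthogonal_gradient[OF assms subspace_span,
        of x0 "iterate_grad (quadratic H c) x0 ` {..<k}" c]
    by (simp only: is_arg_min_search_space_iff[OF assms] grad search_space_def[symmetric]
        inner_span_image_eq_0_iff)
qed

text \<open>Nonzero orthogonal vectors are distinct as well as independent, so the range of the sequence
  would have more elements than the dimension of the space allows.\<close>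

lemma orthogonal_sequence_vanishes:
  fixes g :: "nat \<Rightarrow> 'a::euclidean_space"
  assumes orth: "\<And>i k. i < k \<Longrightarrow> g k \<bullet> g i = 0"
  shows "\<exists>r\<le>DIM('a). g r = 0"
proof (rule ccontr)
  assume "\<not> ?thesis"
  then have nz: "g i \<noteq> 0" if "i \<in> {..DIM('a)}" for i
    using that unfolding atMost_iff by blast
  have orth': "g i \<bullet> g j = 0" if "i \<noteq> j" for i j
    using that orth[of i j] orth[of j i] inner_commute[of "g i" "g j"]
    by (cases i j rule: linorder_cases) simp_all
  have "inj_on g {..DIM('a)}"
  proof (rule inj_onI, rule ccontr)
    fix i j assume "i \<in> {..DIM('a)}" "g i = g j" "i \<noteq> j"
    then show False using orth'[of i j] nz[of i] by simp
  qed
  then have "card (g ` {..DIM('a)}) = DIM('a) + 1" by (simp add: card_image)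
  moreover have "pairwise orthogonal (g ` {..DIM('a)})"
    by (auto simp: pairwise_def orthogonal_def intro!: orth')
  then have "independent (g ` {..DIM('a)})"
    using nz by (intro pairwise_orthogonal_independent) auto
  ultimately show False using independent_bound by fastforce
qed

theorem lemma2p1:
  fixes H :: "real^'n^'n" and c x0 :: "real^'n"
  assumes "sym_pos_def H"
  shows "(\<forall>k\<ge>1.
            (\<exists>!x. is_arg_min (quadratic H c) (\<lambda>y. y \<in> search_space (quadratic H c) x0 k) x)
          \<and> is_arg_min (quadratic H c) (\<lambda>y. y \<in> search_space (quadratic H c) x0 k)
              (iterate (quadratic H c) x0 k)
          \<and> (\<forall>x\<in>search_space (quadratic H c) x0 k.
               x = iterate (quadratic H c) x0 k \<longleftrightarrow>
               (\<forall>i<k. gradient (quadratic H c) x \<bullet> iterate_grad (quadratic H c) x0 i = 0))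
          \<and> (\<forall>i<k. iterate_grad (quadratic H c) x0 k \<bullet> iterate_grad (quadratic H c) x0 i = 0))
       \<and> (\<exists>r\<le>CARD('n). iterate_grad (quadratic H c) x0 r = 0
             \<and> (\<forall>k<r. iterate_grad (quadratic H c) x0 k \<noteq> 0))"
proof -
  let ?q = "quadratic H c"
  let ?V = "search_space ?q x0"
  let ?x = "iterate ?q x0"
  let ?g = "iterate_grad ?q x0"
  have ex1: "\<exists>!x. is_arg_min ?q (\<lambda>y. y \<in> ?V k) x" for k
    using assms by (rule ex1_minimizer_search_space)
  have min: "is_arg_min ?q (\<lambda>y. y \<in> ?V k) (?x k)" if "k \<ge> 1" for k
    unfolding iterate_eq[OF that] using ex1 by (rule theI')
  have char: "x = ?x k \<longleftrightarrow> (\<forall>i<k. gradient ?q x \<bullet> ?g i = 0)" if "k \<ge> 1" "x \<in> ?V k" for k x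
    using ex1[of k] min[OF that(1)] that(2) is_arg_min_search_space_iff[OF assms] by metis
  have orth: "?g k \<bullet> ?g i = 0" if "i < k" for i k
    using min[of k] that unfolding is_arg_min_search_space_iff[OF assms]
    by (simp add: iterate_grad_def)
  define r where "r = (LEAST r. ?g r = 0)"
  obtain m where m: "m \<le> CARD('n)" "?g m = 0"
    using orthogonal_sequence_vanishes[of ?g, OF orth] by auto
  have "r \<le> CARD('n)" using m Least_le[of "\<lambda>r. ?g r = 0" m] by (simp add: r_def)
  moreover have "?g r = 0" unfolding r_def using m(2) by (rule LeastI)
  moreover have "\<forall>k<r. ?g k \<noteq> 0" unfolding r_def using not_less_Least by blast
  ultimately have "\<exists>r\<le>CARD('n). ?g r = 0 \<and> (\<forall>k<r. ?g k \<noteq> 0)" by blast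
  then show ?thesis using ex1 min char orth by (intro conjI allI impI ballI) assumption+
qed

end
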